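(* Let $n,\ell\ge1$ be integers and $\rho_\ell=e^{2\pi i/(2\ell+1)}$. The space $V_n$ of polynomials $p(\bm x,\bm y)$ in $\bm x=(x_1,\dots,x_n)$, $\bm y=(y_1,\dots,y_n)$ with complex coefficients such that (i) $p(\bm x,\bm y)$ is homogeneous in the variables $\{\bm x,\bm y\}$; (ii) $p(\bm x,\bm y)$ is symmetric in the variables $\bm x$, and also in the variables $\bm y$; (iii) $p(\bm x,\bm y)=p(\bm y,\bm x)$; (iv) $p(\bm x,\bm y)$ has total degree at most $\ell n(n-1)$; (v) $p(\bm x,\bm y)$ has partial degree at most $\ell(n-1)$ in each variable $x_i$ or $y_i$; (vi) $p(\bm x,\bm y)$ satisfies the $(\ell,2)_{\rho_\ell^2,\rho_\ell}$-wheel condition; is at most one dimensional (i.e. any two elements of $V_n$ are linearly dependent).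
   Context: Write $\bm z=(z_1,\dots,z_{2n})=(x_1,\dots,x_n,y_1,\dots,y_n)$. The $(\ell,2)_{\rho_\ell^2,\rho_\ell}$-wheel condition for $p(\bm z)$ is: $p(\bm z)=0$ whenever there are indices $1\le i_1<i_2<i_3\le 2n$ and integers $s_1,s_2\ge0$ with $s_1+s_2\le\ell-1$ such that $z_{i_2}=\rho_\ell^{1+2s_1}z_{i_1}$ and $z_{i_3}=\rho_\ell^{1+2s_2}z_{i_2}$. *)

theory Defs
  imports Complex_Main "HOL-Library.Poly_Mapping" "HOL-Combinatorics.Permutations"
begin

text \<open>
  Polynomials in countably many variables \<open>z\<^sub>0, z\<^sub>1, \<dots>\<close> with complex coefficients: a polynomial maps
  exponent vectors to coefficients, both finitely supported. Addition is that of
  \<open>Poly_Mapping\<close>. For given \<open>n\<close> only \<open>z\<^sub>1, \<dots>, z\<^sub>2\<^sub>n\<close> are used, with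
  \<open>x\<^sub>i = z\<^sub>i\<close> and \<open>y\<^sub>i = z\<^sub>n\<^sub>+\<^sub>i\<close> for \<open>1 \<le> i \<le> n\<close>.
\<close>

type_synonym monom = "nat \<Rightarrow>\<^sub>0 nat"
type_synonym cpoly = "monom \<Rightarrow>\<^sub>0 complex"

definition eval_poly :: "cpoly \<Rightarrow> (nat \<Rightarrow> complex) \<Rightarrow> complex" where
  "eval_poly p z = (\<Sum>m\<in>Poly_Mapping.keys p. Poly_Mapping.lookup p m * (\<Prod>i\<in>Poly_Mapping.keys m. z i ^ Poly_Mapping.lookup m i))"

definition scale_poly :: "complex \<Rightarrow> cpoly \<Rightarrow> cpoly" where
  "scale_poly c p = Poly_Mapping.map ((*) c) p"

definition poly_vars :: "cpoly \<Rightarrow> nat set" where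
  "poly_vars p = (\<Union>m\<in>Poly_Mapping.keys p. Poly_Mapping.keys m)"

definition monom_degree :: "monom \<Rightarrow> nat" where
  "monom_degree m = (\<Sum>i\<in>Poly_Mapping.keys m. Poly_Mapping.lookup m i)"

text \<open>The zero polynomial has degree 0, both total and partial, and is homogeneous.\<close>

definition total_degree :: "cpoly \<Rightarrow> nat" where
  "total_degree p = Max (insert 0 (monom_degree ` Poly_Mapping.keys p))"

definition partial_degree :: "nat \<Rightarrow> cpoly \<Rightarrow> nat" where
  "partial_degree i p = Max (insert 0 ((\<lambda>m. Poly_Mapping.lookup m i) ` Poly_Mapping.keys p))"

definition homogeneous_poly :: "cpoly \<Rightarrow> bool" where
  "homogeneous_poly p \<longleftrightarrow> (\<exists>d. \<forall>m\<in>Poly_Mapping.keys p. monom_degree m = d)"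

text \<open>
  For a bijection \<open>\<sigma>\<close> this is the polynomial obtained from \<open>p\<close> by substituting \<open>z\<^sub>i \<mapsto> z\<^bsub>\<sigma>(i)\<^esub>\<close>; see
  \<open>eval_permute_vars\<close> below. (The library's \<open>map_key\<close> is only meaningful for injective maps.)
\<close>

definition permute_vars :: "(nat \<Rightarrow> nat) \<Rightarrow> cpoly \<Rightarrow> cpoly" where
  "permute_vars \<sigma> p = Poly_Mapping.map_key (Poly_Mapping.map_key \<sigma>) p"

lemma inj_map_key:
  assumes "bij \<sigma>"
  shows "inj (Poly_Mapping.map_key \<sigma> :: monom \<Rightarrow> monom)"
proof (rule injI)
  fix a b :: monom
  assume "Poly_Mapping.map_key \<sigma> a = Poly_Mapping.map_key \<sigma> b"
  then have "Poly_Mapping.lookup a (\<sigma> i) = Poly_Mapping.lookup b (\<sigma> i)" for i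
    by (metis assms bij_is_inj map_key.rep_eq comp_apply)
  then show "a = b"
    by (metis assms bij_pointE poly_mapping_eqI)
qed

lemma lookup_permute_vars:
  assumes "bij \<sigma>"
  shows "Poly_Mapping.lookup (permute_vars \<sigma> p) m = Poly_Mapping.lookup p (Poly_Mapping.map_key \<sigma> m)"
  using inj_map_key[OF assms] by (simp add: permute_vars_def map_key.rep_eq)

lemma eval_permute_vars:
  assumes "bij \<sigma>"
  shows "eval_poly (permute_vars \<sigma> p) z = eval_poly p (\<lambda>i. z (\<sigma> i))"
proof -
  let ?f = "Poly_Mapping.map_key \<sigma> :: monom \<Rightarrow> monom"
  let ?g = "Poly_Mapping.map_key (inv \<sigma>) :: monom \<Rightarrow> monom"
  have i: "inj \<sigma>" "inj (inv \<sigma>)"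
    using assms by (auto simp: bij_is_inj bij_imp_bij_inv)
  have fg: "?f (?g m) = m" for m
    by (rule poly_mapping_eqI) (simp add: i map_key.rep_eq)
  have gf: "?g (?f m) = m" for m
    by (rule poly_mapping_eqI) (simp add: i map_key.rep_eq assms bij_is_surj surj_f_inv_f)
  show ?thesis
    unfolding eval_poly_def
  proof (rule sum.reindex_bij_witness[of _ ?g ?f])
    fix m assume "m \<in> Poly_Mapping.keys (permute_vars \<sigma> p)"
    show "Poly_Mapping.lookup p (?f m) * (\<Prod>i\<in>Poly_Mapping.keys (?f m). z (\<sigma> i) ^ Poly_Mapping.lookup (?f m) i)
        = Poly_Mapping.lookup (permute_vars \<sigma> p) m * (\<Prod>i\<in>Poly_Mapping.keys m. z i ^ Poly_Mapping.lookup m i)"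
    proof -
      have "(\<Prod>i\<in>Poly_Mapping.keys (?f m). z (\<sigma> i) ^ Poly_Mapping.lookup (?f m) i) = (\<Prod>i\<in>Poly_Mapping.keys m. z i ^ Poly_Mapping.lookup m i)"
        by (rule prod.reindex_bij_witness[of _ "inv \<sigma>" \<sigma>])
          (use assms in \<open>auto simp: i in_keys_iff map_key.rep_eq bij_is_surj surj_f_inv_f\<close>)
      then show ?thesis by (simp add: lookup_permute_vars[OF assms])
    qed
  qed (auto simp: fg gf in_keys_iff lookup_permute_vars[OF assms])
qed

definition swap_xy :: "nat \<Rightarrow> nat \<Rightarrow> nat" where
  "swap_xy n i = (if i \<in> {1..n} then i + n else if i \<in> {n+1..2*n} then i - n else i)"

lemma bij_swap_xy: "bij (swap_xy n)"
  by (rule involuntory_imp_bij) (auto simp: swap_xy_def)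

definition rho :: "nat \<Rightarrow> complex" where
  "rho l = exp (2 * of_real pi * \<i> / of_nat (2 * l + 1))"

text \<open>The \<open>(l,2)\<close>-wheel condition with parameters \<open>\<rho>\<^sub>l\<^sup>2, \<rho>\<^sub>l\<close>. The bound \<open>s\<^sub>1 + s\<^sub>2 \<le> l - 1\<close> is
  written without natural-number subtraction.\<close>

definition wheel_condition :: "nat \<Rightarrow> nat \<Rightarrow> cpoly \<Rightarrow> bool" where
  "wheel_condition n l p \<longleftrightarrow>
     (\<forall>z. (\<exists>i1 i2 i3 s1 s2. 1 \<le> i1 \<and> i1 < i2 \<and> i2 < i3 \<and> i3 \<le> 2 * n \<and> s1 + s2 + 1 \<le> l \<and>
             z i2 = rho l ^ (1 + 2 * s1) * z i1 \<and> z i3 = rho l ^ (1 + 2 * s2) * z i2)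
          \<longrightarrow> eval_poly p z = 0)"

definition wheel_space :: "nat \<Rightarrow> nat \<Rightarrow> cpoly set" where
  "wheel_space n l = {p.
     poly_vars p \<subseteq> {1..2*n} \<and>
     homogeneous_poly p \<and>
     (\<forall>\<sigma>. \<sigma> permutes {1..n} \<longrightarrow> permute_vars \<sigma> p = p) \<and>
     (\<forall>\<sigma>. \<sigma> permutes {n+1..2*n} \<longrightarrow> permute_vars \<sigma> p = p) \<and>
     permute_vars (swap_xy n) p = p \<and>
     total_degree p \<le> l * n * (n - 1) \<and>
     (\<forall>i\<in>{1..2*n}. partial_degree i p \<le> l * (n - 1)) \<and>
     wheel_condition n l p}"

end

theory Submission
  imports Defs "HOL-Computational_Algebra.Polynomial"
begin

text \<open>
  Write \<open>c a = \<rho>\<^bsup>1 + 2a\<^esup>\<close> for \<open>a < l\<close>, where \<open>\<rho>\<close> is the given root of unity. Given two elements of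
  the space, some nontrivial linear combination \<open>r\<close> of them vanishes at a single chosen point, one with
  \<open>x\<^sub>i = c 0 y\<^sub>i\<close> for all \<open>i\<close>. The proof shows that this one zero forces \<open>r = 0\<close>. Every step is of the
  same kind: all variables but one are fixed, and \<open>r\<close>, which has degree at most \<open>l (n - 1)\<close> in the
  remaining one, is shown to have at least one more root than that.

  The source of roots is the following. Call \<open>x\<^sub>i\<close> and \<open>y\<^sub>i\<close> paired with shift \<open>s\<close> if \<open>x\<^sub>i = c s y\<^sub>i\<close>, and let
  \<open>x\<^sub>k\<close> be free. Each of the \<open>l\<close> values \<open>c a x\<^sub>i\<close> is a root for \<open>x\<^sub>k\<close>, provided that \<open>r\<close> is already known to
  vanish for pairings with a smaller sum of shifts. If \<open>a + s < l\<close>, then the three odd steps with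
  indices \<open>s\<close>, \<open>a\<close> and \<open>l - 1 - a - s\<close> have total exponent \<open>2 l + 1\<close>, so \<open>y\<^sub>i\<close>, \<open>x\<^sub>i\<close>, \<open>x\<^sub>k\<close> form a wheel.
  Otherwise \<open>c a c s = c (a + s - l)\<close>, so it is \<open>x\<^sub>k\<close> that is paired with \<open>y\<^sub>i\<close>, with shift
  \<open>a + s - l < s\<close>, and \<open>x\<^sub>i\<close> has become free; by symmetry in the \<open>x\<close> variables this is a pairing with a
  smaller sum of shifts (\<open>root_at_paired_variable\<close>).

  Fix \<open>y\<close> with distinct nonzero absolute values, so that roots coming from different pairs are
  different, and suppose that \<open>r\<close> vanishes when all pairs have shift \<open>0\<close>. If \<open>n - 1\<close> pairs are present, they
  give \<open>l (n - 1)\<close> roots for the last \<open>x\<^sub>k\<close>, and \<open>c 0 y\<^sub>k\<close> is one more: there all indices are paired, \<open>k\<close> with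
  shift \<open>0\<close>, so dropping a pair of positive shift decreases the sum
  (\<open>vanishes_one_unpaired\<close>). If \<open>m\<close> pairs are present and the claim holds for \<open>m + 1\<close> pairs, then a
  free \<open>x\<^sub>k\<close> has \<open>l m\<close> roots from the pairs and \<open>l (n - m)\<close> roots that pair it with a free \<open>y\<^sub>j\<close>, in total
  \<open>l n\<close>. Descending to \<open>m = 0\<close> gives \<open>r = 0\<close> for this \<open>y\<close> and all \<open>x\<close> (\<open>vanishes_partially_paired\<close>).

  Finally \<open>y\<close> is moved one coordinate \<open>y\<^sub>k\<close> at a time. With \<open>x\<^sub>i = c 0 y\<^sub>i\<close> for \<open>i \<noteq> k\<close>, wheels give
  \<open>l (n - 1)\<close> roots for \<open>y\<^sub>k\<close>, and the old value of \<open>y\<^sub>k\<close> is one more; so the hypothesis of the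
  preceding paragraph holds for the new \<open>y\<close> too (\<open>base_point_after_moving_y\<close>). Letting each \<open>y\<^sub>j\<close> range
  over its own real interval gives zeros on a product of infinite sets, hence \<open>r = 0\<close>.
\<close>

section \<open>Polynomials vanishing on a product of infinite sets\<close>

text \<open>
  Induction on the set of variables: for fixed values of the others, the polynomial in the new
  variable \<open>v\<close> has infinitely many roots, so each of its coefficients vanishes, and these coefficients
  are polynomials in the remaining variables. The exponent vectors are indexed by an arbitrary
  type because only their restriction to \<open>V\<close> matters, and \<open>V\<close> shrinks.
\<close>

lemma coeffs_zero_if_vanishing_on_product:
  fixes c :: "'m \<Rightarrow> 'a::idom" and e :: "'m \<Rightarrow> 'v \<Rightarrow> nat"
  assumes "finite V" and "finite M"
    and "\<And>m m'. m \<in> M \<Longrightarrow> m' \<in> M \<Longrightarrow> (\<forall>i\<in>V. e m i = e m' i) \<Longrightarrow> m = m'"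
    and "\<And>i. i \<in> V \<Longrightarrow> infinite (A i)"
    and "\<And>z. (\<forall>i\<in>V. z i \<in> A i) \<Longrightarrow> (\<Sum>m\<in>M. c m * (\<Prod>i\<in>V. z i ^ e m i)) = 0"
    and "m \<in> M"
  shows "c m = 0"
  using assms
proof (induction V arbitrary: M m rule: finite_induct)
  case empty
  then have "M = {m}" by auto
  then show ?case using empty.prems(4)[of undefined] by simp
next
  case (insert v V)
  \<comment> \<open>the monomials contributing to the same power of \<open>v\<close> as \<open>m\<close>; they differ already on \<open>V\<close>\<close>
  define N where "N = {m' \<in> M. e m' v = e m v}"
  show ?case
  proof (rule insert.IH[of N])
    show "finite N" "m \<in> N" using insert.prems by (auto simp: N_def)
    show "m' = m''" if "m' \<in> N" "m'' \<in> N" "\<forall>i\<in>V. e m' i = e m'' i" for m' m''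
      using that insert.prems(2)[of m' m''] by (auto simp: N_def)
    show "infinite (A i)" if "i \<in> V" for i using that insert.prems(3) by auto
    fix z assume z: "\<forall>i\<in>V. z i \<in> A i"
    define b where "b m' = c m' * (\<Prod>i\<in>V. z i ^ e m' i)" for m'
    define P where "P = (\<Sum>m'\<in>M. monom (b m') (e m' v))"
    have "poly P t = 0" if "t \<in> A v" for t
    proof -
      have "(\<Prod>i\<in>V. (z(v := t)) i ^ e m' i) = (\<Prod>i\<in>V. z i ^ e m' i)" for m'
        using insert.hyps by (intro prod.cong) auto
      moreover have "(\<Sum>m'\<in>M. c m' * (\<Prod>i\<in>insert v V. (z(v := t)) i ^ e m' i)) = 0"
        by (rule insert.prems(4)) (use that z in auto)
      ultimately show ?thesis
        using insert.hyps by (simp add: P_def b_def poly_sum poly_monom algebra_simps)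
    qed
    then have "infinite {t. poly P t = 0}"
      using insert.prems(3)[of v] by (metis (mono_tags, lifting) insertI1 mem_Collect_eq rev_finite_subset subsetI)
    then have "P = 0" using poly_roots_finite by blast
    then have "coeff P (e m v) = 0" by simp
    moreover have "coeff P (e m v) = (\<Sum>m'\<in>N. b m')"
      using insert.prems(1) unfolding P_def N_def coeff_sum coeff_monom
      by (subst sum.inter_filter) (auto intro: sum.cong)
    ultimately show "(\<Sum>m'\<in>N. c m' * (\<Prod>i\<in>V. z i ^ e m' i)) = 0"
      by (simp add: b_def)
  qed
qed

section \<open>Odd powers of the root of unity\<close>

definition odd_power :: "nat \<Rightarrow> nat \<Rightarrow> complex" where
  "odd_power l a = rho l ^ (1 + 2 * a)"

lemma rho_power_eq_cis: "rho l ^ k = cis (2 * pi * real k / real (2 * l + 1))"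
proof -
  have "rho l = cis (2 * pi / real (2 * l + 1))"
    by (simp add: rho_def cis_conv_exp mult.commute)
  then show ?thesis by (simp only: DeMoivre) (simp add: mult.commute)
qed

lemma rho_power_order: "rho l ^ (2 * l + 1) = 1"
  unfolding rho_power_eq_cis by simp

lemma rho_nonzero: "rho l \<noteq> 0"
  by (simp add: rho_def)

lemma norm_odd_power [simp]: "norm (odd_power l a) = 1"
  unfolding odd_power_def rho_power_eq_cis by simp

text \<open>
  The exponents of three such odd steps add up to \<open>3 + 2 (a + b + s) = 2 l + 1\<close>: going round a wheel
  returns to the starting point.
\<close>

lemma odd_power_cycle:
  assumes "a + b + s + 1 = l"
  shows "odd_power l a * odd_power l b * odd_power l s = 1"
proof -
  have "odd_power l a * odd_power l b * odd_power l s = rho l ^ ((1 + 2*a) + (1 + 2*b) + (1 + 2*s))"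
    by (simp only: odd_power_def power_add)
  also have "(1 + 2*a) + (1 + 2*b) + (1 + 2*s) = 2 * l + 1" using assms by simp
  finally show ?thesis by (simp only: rho_power_order)
qed

text \<open>
  Two odd steps make an even one, but subtracting the odd order \<open>2 l + 1\<close> makes it odd again.
\<close>

lemma odd_power_mult_wrap:
  assumes "l \<le> a + s"
  shows "odd_power l a * odd_power l s = odd_power l (a + s - l)"
proof -
  have "odd_power l a * odd_power l s = rho l ^ ((1 + 2*a) + (1 + 2*s))"
    by (simp only: odd_power_def power_add)
  also have "(1 + 2*a) + (1 + 2*s) = (2 * l + 1) + (1 + 2 * (a + s - l))" using assms by simp
  finally show ?thesis by (simp only: rho_power_order power_add[of _ "2*l+1"] odd_power_def mult_1)
qed

lemma inj_on_odd_power: "inj_on (odd_power l) {..<l}"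
proof (rule linorder_inj_onI')
  fix a b assume ab: "a \<in> {..<l}" "b \<in> {..<l}" "a < b"
  show "odd_power l a \<noteq> odd_power l b"
  proof
    assume "odd_power l a = odd_power l b"
    moreover have "1 + 2 * b = (1 + 2 * a) + 2 * (b - a)" using ab by simp
    ultimately have "rho l ^ (1 + 2*a) = rho l ^ (1 + 2*a) * rho l ^ (2 * (b - a))"
      by (metis odd_power_def power_add)
    then have "rho l ^ (2 * (b - a)) = 1" using rho_nonzero by simp
    then have "cos (2 * pi * real (2 * (b - a)) / real (2 * l + 1)) = 1"
      unfolding rho_power_eq_cis by (metis cis.sel(1) one_complex.sel(1))
    then obtain k :: int where "2 * pi * real (2 * (b - a)) / real (2 * l + 1) = of_int k * 2 * pi"
      unfolding cos_one_2pi_int by blast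
    then have "pi * real (2 * (b - a)) = pi * (of_int k * real (2 * l + 1))"
      by (simp add: field_simps)
    then have "real (2 * (b - a)) = of_int k * real (2 * l + 1)"
      by (simp only: mult_left_cancel[OF pi_neq_zero])
    then have k: "int (2 * (b - a)) = k * int (2 * l + 1)"
      by (metis of_int_eq_iff of_int_mult of_int_of_nat_eq)
    have "int (2 * (b - a)) < int (2 * l + 1)" "0 < int (2 * (b - a))" using ab by auto
    then show False using k
      by (metis dvd_triv_right zdvd_not_zless)
  qed
qed

text \<open>
  Odd powers have absolute value \<open>1\<close>, so rotations of numbers with different absolute values are
  different. This gives all root counts below.
\<close>

lemma card_rotations:
  fixes v :: "'i \<Rightarrow> complex"
  assumes "inj_on (\<lambda>i. norm (v i)) I" and "\<And>i. i \<in> I \<Longrightarrow> v i \<noteq> 0"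
  shows "card ((\<lambda>(i, a). odd_power l a * v i) ` (I \<times> {..<l})) = card I * l"
proof -
  have "inj_on (\<lambda>(i, a). odd_power l a * v i) (I \<times> {..<l})"
  proof (rule inj_onI)
    fix x y
    assume xy: "x \<in> I \<times> {..<l}" "y \<in> I \<times> {..<l}"
      "(\<lambda>(i, a). odd_power l a * v i) x = (\<lambda>(i, a). odd_power l a * v i) y"
    obtain i a j b where x: "x = (i, a)" and y: "y = (j, b)" by (cases x, cases y)
    have *: "i \<in> I" "j \<in> I" "a \<in> {..<l}" "b \<in> {..<l}" "odd_power l a * v i = odd_power l b * v j"
      using xy by (auto simp: x y)
    have "norm (v i) = norm (v j)"
      using arg_cong[OF *(5), of norm] by (simp add: norm_mult)
    then have "i = j" using inj_onD[OF assms(1)] * by blast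
    then show "x = y" unfolding x y
      using * assms(2) inj_on_odd_power[of l] by (auto dest: inj_onD)
  qed
  then show ?thesis by (simp add: card_image card_cartesian_product)
qed

section \<open>Functions satisfying the wheel condition\<close>

text \<open>
  The argument only ever substitutes numbers for variables, so it is carried out for functions that
  are polynomials in each variable separately. All these conditions pass to linear combinations, and
  none of them refers to coefficients. The variables \<open>x\<^sub>i\<close> and \<open>y\<^sub>i\<close> are \<open>z i\<close> and \<open>z (n + i)\<close>
  for \<open>i \<in> {1..n}\<close>.
\<close>

locale wheel_function =
  fixes n l :: nat and r :: "(nat \<Rightarrow> complex) \<Rightarrow> complex"
  assumes n_pos: "n \<ge> 1" and l_pos: "l \<ge> 1"
    and partial_poly: "i \<in> {1..2*n} \<Longrightarrow> \<exists>P. degree P \<le> l * (n - 1) \<and> (\<forall>t. r (z(i := t)) = poly P t)"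
    and sym_x: "\<sigma> permutes {1..n} \<Longrightarrow> r (\<lambda>i. z (\<sigma> i)) = r z"
    and sym_y: "\<sigma> permutes {n+1..2*n} \<Longrightarrow> r (\<lambda>i. z (\<sigma> i)) = r z"
    and wheel: "1 \<le> i1 \<Longrightarrow> i1 < i2 \<Longrightarrow> i2 < i3 \<Longrightarrow> i3 \<le> 2 * n \<Longrightarrow> s1 + s2 + 1 \<le> l \<Longrightarrow>
        z i2 = odd_power l s1 * z i1 \<Longrightarrow> z i3 = odd_power l s2 * z i2 \<Longrightarrow> r z = 0"
begin

abbreviation c :: "nat \<Rightarrow> complex" where "c \<equiv> odd_power l"

lemma vanishes_if_many_roots:
  assumes "i \<in> {1..2*n}" and "finite R" and "card R > l * (n - 1)"
    and "\<And>t. t \<in> R \<Longrightarrow> r (z(i := t)) = 0"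
  shows "r (z(i := t)) = 0"
proof -
  obtain P where P: "degree P \<le> l * (n - 1)" "\<And>t. r (z(i := t)) = poly P t"
    using partial_poly[OF assms(1)] by blast
  have "P = 0"
  proof (rule ccontr)
    assume "P \<noteq> 0"
    then have "card R \<le> card {t. poly P t = 0}"
      using assms(4) P(2) by (intro card_mono poly_roots_finite) auto
    also have "\<dots> \<le> degree P" by (rule card_poly_roots_bound) fact
    finally show False using assms(3) P(1) by simp
  qed
  then show ?thesis using P(2) by simp
qed

lemma swap_x:
  assumes "i \<in> {1..n}" and "j \<in> {1..n}"
  shows "r (\<lambda>k. z (transpose i j k)) = r z"
  using sym_x[OF permutes_swap_id[OF assms]] .

lemma swap_y:
  assumes "i \<in> {n+1..2*n}" and "j \<in> {n+1..2*n}"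
  shows "r (\<lambda>k. z (transpose i j k)) = r z"
  using sym_y[OF permutes_swap_id[OF assms]] .

text \<open>
  The wheel condition prescribes an order of the three indices. A triple with two \<open>x\<close> variables and one
  \<open>y\<close> variable (or vice versa) may be taken in any order, by symmetry in the two variables of the same kind.
\<close>

lemma wheel_xxy:
  assumes "i \<in> {1..n}" "k \<in> {1..n}" "i \<noteq> k" "j \<in> {n+1..2*n}" "s1 + s2 + 1 \<le> l"
    and "z k = c s1 * z i" "z j = c s2 * z k"
  shows "r z = 0"
proof (cases "i < k")
  case True
  show ?thesis by (rule wheel[of i k j s1 s2]) (use True assms in auto)
next
  case False
  have "r (\<lambda>m. z (transpose i k m)) = 0"
    by (rule wheel[of k i j s1 s2]) (use False assms in \<open>auto simp: transpose_def\<close>)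
  then show ?thesis using swap_x[OF assms(1,2)] by simp
qed

lemma wheel_xyy:
  assumes "i \<in> {1..n}" "k \<in> {n+1..2*n}" "j \<in> {n+1..2*n}" "j \<noteq> k" "s1 + s2 + 1 \<le> l"
    and "z k = c s1 * z i" "z j = c s2 * z k"
  shows "r z = 0"
proof (cases "k < j")
  case True
  show ?thesis by (rule wheel[of i k j s1 s2]) (use True assms in auto)
next
  case False
  have "r (\<lambda>m. z (transpose k j m)) = 0"
    by (rule wheel[of i j k s1 s2]) (use False assms in \<open>auto simp: transpose_def\<close>)
  then show ?thesis using swap_y[OF assms(2,3)] by simp
qed

definition paired :: "nat set \<Rightarrow> (nat \<Rightarrow> nat) \<Rightarrow> (nat \<Rightarrow> complex) \<Rightarrow> bool" where
  "paired J s z \<longleftrightarrow> (\<forall>i\<in>J. s i < l \<and> z i = c (s i) * z (n + i))"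

text \<open>
  Only the values outside \<open>{1..n}\<close> are compared, including those beyond \<open>2 n\<close>, so that two such
  points differ in the \<open>x\<close> variables alone.
\<close>

definition same_y :: "(nat \<Rightarrow> complex) \<Rightarrow> (nat \<Rightarrow> complex) \<Rightarrow> bool" where
  "same_y Y z \<longleftrightarrow> (\<forall>j. j \<notin> {1..n} \<longrightarrow> z j = Y j)"

text \<open>
  Distinct absolute values are a convenient sufficient condition for \<open>y\<^sub>1, \<dots>, y\<^sub>n\<close> to have disjoint
  orbits under multiplication by powers of the root of unity.
\<close>

definition generic :: "(nat \<Rightarrow> complex) \<Rightarrow> bool" where
  "generic Y \<longleftrightarrow> inj_on (\<lambda>i. norm (Y (n + i))) {1..n} \<and> (\<forall>i\<in>{1..n}. Y (n + i) \<noteq> 0)"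

text \<open>
  The variable \<open>x\<^sub>k\<close> is free and takes one of the \<open>l\<close> values \<open>c a x\<^sub>i\<close> attached to a paired \<open>x\<^sub>i\<close>. For
  \<open>a + s i < l\<close> a wheel closes up through \<open>y\<^sub>i\<close>. Otherwise \<open>x\<^sub>k\<close> is itself a partner of \<open>y\<^sub>i\<close>, with
  smaller shift, and exchanging \<open>x\<^sub>i\<close> and \<open>x\<^sub>k\<close> leads to the induction hypothesis.
\<close>

lemma root_at_paired_variable:
  assumes J: "J \<subseteq> {1..n}" and k: "k \<in> {1..n} - J" and i: "i \<in> J" and a: "a < l"
    and Y: "same_y Y z" and pair: "paired J s z"
    and IH: "\<And>s' z'. same_y Y z' \<Longrightarrow> paired J s' z' \<Longrightarrow> sum s' J < sum s J \<Longrightarrow> r z' = 0"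
  shows "r (z(k := c a * z i)) = 0"
proof -
  have i': "i \<in> {1..n}" "i \<noteq> k" using J i k by auto
  have si: "s i < l" "z i = c (s i) * z (n + i)" using pair i by (auto simp: paired_def)
  show ?thesis
  proof (cases "a + s i < l")
    case True
    \<comment> \<open>the third step, from \<open>x\<^sub>k\<close> to \<open>y\<^sub>i\<close>, that closes the wheel\<close>
    define b where "b = l - 1 - a - s i"
    have "c a * c b * c (s i) = 1"
      by (rule odd_power_cycle) (use True in \<open>auto simp: b_def\<close>)
    then have b: "z (n + i) = c b * (c a * z i)"
      using si by (metis mult.assoc mult.commute mult_1)
    show ?thesis
      by (rule wheel_xxy[of i k "n + i" a b]) (use i' k b True in \<open>auto simp: b_def\<close>)
  next
    case False
    define s' where "s' = s(i := a + s i - l)"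
    define z' where "z' = (\<lambda>m. (z(k := c a * z i)) (transpose i k m))"
    have "r z' = 0"
    proof (rule IH)
      show "same_y Y z'"
        using Y i' k by (auto simp: same_y_def z'_def transpose_def)
      have "c a * z i = c (s' i) * z (n + i)"
        using odd_power_mult_wrap[of l a "s i"] False si by (simp add: s'_def mult.assoc[symmetric])
      then show "paired J s' z'"
        unfolding paired_def
      proof (intro ballI conjI, goal_cases)
        case (1 m) then show ?case using pair a si by (auto simp: s'_def paired_def)
      next
        case (2 m)
        have "m \<noteq> k" "n + m \<noteq> i" "n + m \<noteq> k" using 2 J i' k by auto
        then show ?case using 2 pair by (auto simp: s'_def z'_def paired_def transpose_def)
      qed
      have "finite J" using J finite_subset by blast
      then show "sum s' J < sum s J"
        using i a False si by (intro sum_strict_mono_ex1) (auto simp: s'_def)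
    qed
    then show ?thesis using swap_x[of i k "z(k := c a * z i)"] i' k unfolding z'_def by simp
  qed
qed

definition base_point :: "(nat \<Rightarrow> complex) \<Rightarrow> nat \<Rightarrow> complex" where
  "base_point Y i = (if i \<in> {1..n} then c 0 * Y (n + i) else Y i)"

lemma norm_paired:
  assumes "paired J s z" "same_y Y z" "J \<subseteq> {1..n}" "i \<in> J"
  shows "norm (z i) = norm (Y (n + i))"
  using assms by (auto simp: paired_def same_y_def norm_mult)

text \<open>
  The \<open>n - 1\<close> pairs give \<open>l (n - 1)\<close> roots for \<open>x\<^sub>k\<close>, exactly the degree bound. The extra root is
  \<open>c 0 y\<^sub>k\<close>: there \<open>k\<close> is paired as well, with the smallest shift, so another index \<open>i\<close> with positive shift
  can be declared free in its place, which lowers the sum of shifts; if no such \<open>i\<close> exists, the point is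
  the base point.
\<close>

lemma vanishes_one_unpaired:
  assumes gen: "generic Y" and base: "r (base_point Y) = 0"
    and "k \<in> {1..n}" and "same_y Y z" and "paired ({1..n} - {k}) s z"
  shows "r z = 0"
  using assms(3-)
proof (induction "sum s ({1..n} - {k})" arbitrary: k s z rule: less_induct)
  case less
  define J where "J = {1..n} - {k}"
  define R where "R = (\<lambda>(i, a). c a * z i) ` (J \<times> {..<l})"
  note k = less.prems(1) and Y = less.prems(2)
  have pair: "paired J s z" using less.prems(3) by (simp add: J_def)
  have nz: "norm (z i) = norm (Y (n + i))" if "i \<in> J" for i
    using norm_paired[OF pair Y _ that] by (auto simp: J_def)
  have inj: "inj_on (\<lambda>i. norm (Y (n + i))) {1..n}" and ne: "\<And>i. i \<in> {1..n} \<Longrightarrow> Y (n + i) \<noteq> 0"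
    using gen by (auto simp: generic_def)
  have "card R = card J * l"
    unfolding R_def
  proof (rule card_rotations)
    have "inj_on (\<lambda>i. norm (Y (n + i))) J" using inj by (rule inj_on_subset) (auto simp: J_def)
    then show "inj_on (\<lambda>i. norm (z i)) J" using nz by (simp cong: inj_on_cong)
    show "z i \<noteq> 0" if "i \<in> J" for i using nz[OF that] ne[of i] that by (auto simp: J_def)
  qed
  then have cR: "card R = l * (n - 1)" using k by (simp add: J_def)
  have fR: "finite R" by (simp add: R_def J_def)
  have "c 0 * Y (n + k) \<notin> R"
  proof
    assume "c 0 * Y (n + k) \<in> R"
    then obtain i a where "i \<in> J" "c 0 * Y (n + k) = c a * z i" by (auto simp: R_def)
    then have "norm (Y (n + k)) = norm (Y (n + i))"
      using nz by (metis norm_mult norm_odd_power mult_1)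
    then have "k = i" using inj k \<open>i \<in> J\<close> by (auto simp: J_def dest: inj_onD)
    then show False using \<open>i \<in> J\<close> by (simp add: J_def)
  qed
  then have card: "card (insert (c 0 * Y (n + k)) R) > l * (n - 1)" using cR fR by simp
  have "r (z(k := z k)) = 0"
  proof (rule vanishes_if_many_roots[OF _ _ card])
    show "k \<in> {1..2*n}" "finite (insert (c 0 * Y (n + k)) R)" using k fR by auto
    fix t assume "t \<in> insert (c 0 * Y (n + k)) R"
    then consider (extra) "t = c 0 * Y (n + k)" | (root) i a where "i \<in> J" "a < l" "t = c a * z i"
      by (auto simp: R_def)
    then show "r (z(k := t)) = 0"
    proof cases
      case root
      show ?thesis unfolding root(3)
        by (rule root_at_paired_variable[where J = J and s = s, OF _ _ root(1,2) Y pair])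
           (use k less.hyps in \<open>auto simp: J_def\<close>)
    next
      case extra
      show ?thesis
      proof (cases "\<forall>i\<in>J. s i = 0")
        case True
        have "z(k := t) = base_point Y"
        proof
          fix j
          show "(z(k := t)) j = base_point Y j"
            using True pair Y extra k
            by (cases "j = k") (auto simp: base_point_def paired_def same_y_def J_def)
        qed
        then show ?thesis using base by simp
      next
        case False
        then obtain i where i: "i \<in> J" "s i > 0" by auto
        define s' where "s' = s(k := 0)"
        have "sum s' ({1..n} - {i}) = sum s ({1..n} - {i} - {k})"
          using k i by (subst sum.remove[of _ k]) (auto simp: s'_def J_def intro!: sum.cong)
        also have "\<dots> < sum s J"
          using i by (subst (2) sum.remove[of _ i]) (auto simp: J_def Diff_insert2[symmetric] insert_commute)
        finally have lt: "sum s' ({1..n} - {i}) < sum s ({1..n} - {k})" by (simp add: J_def)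
        show ?thesis
        proof (rule less.hyps[OF lt])
          show "i \<in> {1..n}" using i by (simp add: J_def)
          show "same_y Y (z(k := t))" using Y k by (auto simp: same_y_def)
          show "paired ({1..n} - {i}) s' (z(k := t))"
            unfolding paired_def
          proof
            fix m assume m: "m \<in> {1..n} - {i}"
            then have "n + m \<noteq> k" "z (n + m) = Y (n + m)" using k Y by (auto simp: same_y_def)
            then show "s' m < l \<and> (z(k := t)) m = c (s' m) * (z(k := t)) (n + m)"
              using pair extra m l_pos by (auto simp: paired_def s'_def J_def)
          qed
        qed
      qed
    qed
  qed
  then show ?case by simp
qed

text \<open>
  The outer induction adds pairs, the inner one lowers the sum of shifts. The free variable \<open>x\<^sub>k\<close> has \<open>l\<close>
  roots for every index: for \<open>i \<in> J\<close> those attached to the pair, and for \<open>i \<notin> J\<close> the values that make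
  \<open>x\<^sub>k\<close> a partner of the free \<open>y\<^sub>i\<close>. Together these are \<open>l n > l (n - 1)\<close>.
\<close>

lemma vanishes_partially_paired:
  assumes gen: "generic Y" and base: "r (base_point Y) = 0"
    and "J \<subseteq> {1..n}" and "same_y Y z" and "paired J s z"
  shows "r z = 0"
  using assms(3-)
proof (induction "n - card J" arbitrary: J s z)
  case 0
  then have "card J \<ge> card {1..n}" by simp
  then have "J = {1..n}" using 0 by (simp add: card_seteq)
  then show ?case
    using vanishes_one_unpaired[OF gen base, of n z s] 0 n_pos by (auto simp: paired_def)
next
  case (Suc d)
  note outer = Suc.hyps(1)
  have d: "Suc d = n - card J" and J: "J \<subseteq> {1..n}" using Suc by auto
  have fJ: "finite J" using J finite_subset by blast
  have "J \<noteq> {1..n}" using d by auto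
  then obtain k where k: "k \<in> {1..n} - J" using J by blast
  show ?case using Suc.prems(2,3)
  proof (induction "sum s J" arbitrary: s z rule: less_induct)
    case less
    note Y = less.prems(1) and pair = less.prems(2)
    \<comment> \<open>all roots have the form \<open>c a * v i\<close>, and \<open>v i\<close> has the absolute value of \<open>y\<^sub>i\<close> in both cases\<close>
    define v where "v i = (if i \<in> J then z i else Y (n + i))" for i
    define R where "R = (\<lambda>(i, a). c a * v i) ` ({1..n} \<times> {..<l})"
    have nv: "norm (v i) = norm (Y (n + i))" for i
      using norm_paired[OF pair Y J] by (auto simp: v_def)
    have "card R = card {1..n} * l"
      unfolding R_def
    proof (rule card_rotations)
      show "inj_on (\<lambda>i. norm (v i)) {1..n}" using gen by (simp add: nv generic_def)
      show "v i \<noteq> 0" if "i \<in> {1..n}" for i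
        using nv[of i] gen that by (auto simp: generic_def)
    qed
    then have card: "card R > l * (n - 1)"
      using n_pos l_pos by (cases n) (auto simp: algebra_simps)
    have "r (z(k := z k)) = 0"
    proof (rule vanishes_if_many_roots[OF _ _ card])
      show "k \<in> {1..2*n}" "finite R" using k by (auto simp: R_def)
      fix t assume "t \<in> R"
      then obtain i a where ia: "i \<in> {1..n}" "a < l" "t = c a * v i" by (auto simp: R_def)
      show "r (z(k := t)) = 0"
      proof (cases "i \<in> J")
        case True
        then have t: "t = c a * z i" using ia by (simp add: v_def)
        show ?thesis unfolding t
          by (rule root_at_paired_variable[where J = J and s = s, OF J k True ia(2) Y pair])
             (use less.hyps in auto)
      next
        case False
        then have t: "t = c a * Y (n + i)" using ia by (simp add: v_def)
        \<comment> \<open>\<open>x\<^sub>k\<close> is a partner of \<open>y\<^sub>i\<close>; exchanging it with \<open>x\<^sub>i\<close> makes the indices agree\<close>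
        define z' where "z' = (\<lambda>m. (z(k := t)) (transpose i k m))"
        have "r z' = 0"
        proof (rule outer)
          show "d = n - card (insert i J)" using d False fJ by simp
          show "insert i J \<subseteq> {1..n}" using ia J by simp
          show "same_y Y z'" using Y ia k by (auto simp: same_y_def z'_def transpose_def)
          show "paired (insert i J) (s(i := a)) z'"
            unfolding paired_def
          proof
            fix m assume m: "m \<in> insert i J"
            then have "n + m \<noteq> i" "n + m \<noteq> k" "z (n + m) = Y (n + m)"
              using ia J k Y by (auto simp: same_y_def)
            then show "(s(i := a)) m < l \<and> z' m = c ((s(i := a)) m) * z' (n + m)"
              using m pair ia k t False by (auto simp: paired_def z'_def transpose_def)
          qed
        qed
        then show ?thesis using swap_x[of i k "z(k := t)"] ia k unfolding z'_def by simp
      qed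
    qed
    then show ?case by simp
  qed
qed

lemma vanishes_for_all_x:
  assumes "generic Y" and "r (base_point Y) = 0" and "same_y Y z"
  shows "r z = 0"
  using vanishes_partially_paired[OF assms(1,2), of "{}" z] assms(3) by (simp add: paired_def)

text \<open>
  At the new base point all \<open>x\<close> variables are kept and \<open>y\<^sub>k\<close> is varied. Each \<open>i \<noteq> k\<close> has shift \<open>0\<close>, so all
  \<open>l\<close> values \<open>c a x\<^sub>i\<close> of \<open>y\<^sub>k\<close> close a wheel with \<open>x\<^sub>i\<close> and \<open>y\<^sub>i\<close>. The old value of \<open>y\<^sub>k\<close> is one more root
  because there \<open>r\<close> vanishes for all \<open>x\<close>.
\<close>

lemma base_point_after_moving_y:
  assumes gen: "generic Y" and gen': "generic (Y(n + k := t))" and k: "k \<in> {1..n}"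
    and van: "\<And>z. same_y Y z \<Longrightarrow> r z = 0"
  shows "r (base_point (Y(n + k := t))) = 0"
proof -
  define z where "z = base_point (Y(n + k := t))"
  define J where "J = {1..n} - {k}"
  define R where "R = (\<lambda>(i, a). c a * z i) ` (J \<times> {..<l})"
  have zJ: "z i = c 0 * Y (n + i)" "z (n + i) = Y (n + i)" if "i \<in> J" for i
    using that by (auto simp: J_def z_def base_point_def)
  then have nz: "norm (z i) = norm (Y (n + i))" if "i \<in> J" for i
    using that by (simp add: norm_mult)
  have inj: "inj_on (\<lambda>i. norm (Y (n + i))) {1..n}" and ne: "\<And>i. i \<in> {1..n} \<Longrightarrow> Y (n + i) \<noteq> 0"
    using gen by (auto simp: generic_def)
  have "card R = card J * l"
    unfolding R_def
  proof (rule card_rotations)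
    have "inj_on (\<lambda>i. norm (Y (n + i))) J" using inj by (rule inj_on_subset) (auto simp: J_def)
    then show "inj_on (\<lambda>i. norm (z i)) J" using nz by (simp cong: inj_on_cong)
    show "z i \<noteq> 0" if "i \<in> J" for i using nz[OF that] ne[of i] that by (auto simp: J_def)
  qed
  then have cR: "card R = l * (n - 1)" using k by (simp add: J_def)
  have fR: "finite R" by (simp add: R_def J_def)
  have "Y (n + k) \<notin> R"
  proof
    assume "Y (n + k) \<in> R"
    then obtain i a where "i \<in> J" "Y (n + k) = c a * z i" by (auto simp: R_def)
    then have "norm (Y (n + k)) = norm (Y (n + i))"
      using nz by (metis norm_mult norm_odd_power mult_1)
    then have "k = i" using inj k \<open>i \<in> J\<close> by (auto simp: J_def dest: inj_onD)
    then show False using \<open>i \<in> J\<close> by (simp add: J_def)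
  qed
  then have card: "card (insert (Y (n + k)) R) > l * (n - 1)" using cR fR by simp
  have "r (z(n + k := z (n + k))) = 0"
  proof (rule vanishes_if_many_roots[OF _ _ card])
    show "n + k \<in> {1..2*n}" "finite (insert (Y (n + k)) R)" using k fR by auto
    fix u assume "u \<in> insert (Y (n + k)) R"
    then consider (old) "u = Y (n + k)" | (root) i a where "i \<in> J" "a < l" "u = c a * z i"
      by (auto simp: R_def)
    then show "r (z(n + k := u)) = 0"
    proof cases
      case old
      then show ?thesis by (intro van) (auto simp: same_y_def z_def base_point_def)
    next
      case root
      define b where "b = l - 1 - a"
      have "c a * c b * c 0 = 1"
        by (rule odd_power_cycle) (use root in \<open>auto simp: b_def\<close>)
      then have b: "z (n + i) = c b * (c a * z i)"
        using zJ[OF root(1)] by (metis mult.assoc mult.commute mult_1)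
      show ?thesis
        by (rule wheel_xyy[of i "n + k" "n + i" a b]) (use root k b in \<open>auto simp: b_def J_def\<close>)
    qed
  qed
  then show ?thesis by (simp add: z_def)
qed

text \<open>
  Disjoint intervals for the \<open>y\<close> variables: every point of this region is generic, so it can be
  crossed one coordinate at a time without meeting a degenerate point.
\<close>

definition y_region :: "(nat \<Rightarrow> complex) set" where
  "y_region = {Y. \<forall>j\<in>{n+1..2*n}. \<exists>u::real. real j < u \<and> u < real j + 1 \<and> Y j = of_real u}"

lemma generic_y_region:
  assumes "Y \<in> y_region"
  shows "generic Y"
proof -
  have *: "real (n + i) < norm (Y (n + i)) \<and> norm (Y (n + i)) < real (n + i) + 1"
    if "i \<in> {1..n}" for i
  proof -
    have "n + i \<in> {n+1..2*n}" using that by auto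
    then obtain u where "real (n + i) < u" "u < real (n + i) + 1" "Y (n + i) = of_real u"
      using assms by (auto simp only: y_region_def mem_Collect_eq)
    then show ?thesis by simp
  qed
  show ?thesis
    unfolding generic_def
  proof (intro conjI inj_onI ballI)
    fix i j assume "i \<in> {1..n}" "j \<in> {1..n}" "norm (Y (n + i)) = norm (Y (n + j))"
    then show "i = j" using *[of i] *[of j] by simp
  next
    fix i assume "i \<in> {1..n}"
    then show "Y (n + i) \<noteq> 0" using *[of i] by auto
  qed
qed

lemma vanishes_on_y_region:
  assumes Y0: "Y0 \<in> y_region" and base: "r (base_point Y0) = 0"
    and Y: "Y \<in> y_region" "\<And>j. j \<notin> {n+1..2*n} \<Longrightarrow> Y j = Y0 j" and z: "same_y Y z"
  shows "r z = 0"
proof -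
  have "finite {n+1..2*n}" by simp
  then have "\<forall>Y\<in>y_region. (\<forall>j. j \<notin> S \<longrightarrow> Y j = Y0 j) \<longrightarrow> (\<forall>z. same_y Y z \<longrightarrow> r z = 0)"
    if "S \<subseteq> {n+1..2*n}" for S
    using that
  proof (induction S rule: infinite_finite_induct)
    case (infinite S) then show ?case using finite_subset by blast
  next
    case empty
    have "Y = Y0" if "\<forall>j. j \<notin> {} \<longrightarrow> Y j = Y0 j" for Y using that by auto
    then show ?case using vanishes_for_all_x[OF generic_y_region[OF Y0] base] by blast
  next
    case (insert j S)
    show ?case
    proof (intro ballI impI allI)
      fix Y z assume Y: "Y \<in> y_region" "\<forall>i. i \<notin> insert j S \<longrightarrow> Y i = Y0 i" and z: "same_y Y z"
      define X where "X = Y(j := Y0 j)"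
      have X: "X \<in> y_region" using Y(1) Y0 by (auto simp: y_region_def X_def)
      have "j \<in> {n+1..2*n}" using insert by simp
      then obtain k where k: "j = n + k" "k \<in> {1..n}"
        by (intro that[of "j - n"]) auto
      have YX: "X(n + k := Y j) = Y" by (simp add: X_def k)
      have "\<forall>i. i \<notin> S \<longrightarrow> X i = Y0 i" using Y(2) by (auto simp: X_def)
      then have "r w = 0" if "same_y X w" for w using insert X that by auto
      then have "r (base_point Y) = 0"
        using base_point_after_moving_y[OF generic_y_region[OF X], of k "Y j"] k
          generic_y_region[OF Y(1)] YX by simp
      then show "r z = 0" using vanishes_for_all_x[OF generic_y_region[OF Y(1)]] z by blast
    qed
  qed
  then show ?thesis using Y z by blast
qed

end

section \<open>Evaluation of polynomials\<close>

lemma eval_poly_over_superset: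
  assumes "finite M" "Poly_Mapping.keys p \<subseteq> M" "finite V" "poly_vars p \<subseteq> V"
  shows "eval_poly p z = (\<Sum>m\<in>M. Poly_Mapping.lookup p m * (\<Prod>i\<in>V. z i ^ Poly_Mapping.lookup m i))"
proof -
  have "(\<Prod>i\<in>Poly_Mapping.keys m. z i ^ Poly_Mapping.lookup m i) = (\<Prod>i\<in>V. z i ^ Poly_Mapping.lookup m i)"
    if "m \<in> Poly_Mapping.keys p" for m
  proof (rule prod.mono_neutral_left)
    show "Poly_Mapping.keys m \<subseteq> V" using that assms(4) unfolding poly_vars_def by blast
  qed (use assms(3) in \<open>auto simp: in_keys_iff\<close>)
  then have "eval_poly p z = (\<Sum>m\<in>Poly_Mapping.keys p. Poly_Mapping.lookup p m * (\<Prod>i\<in>V. z i ^ Poly_Mapping.lookup m i))"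
    unfolding eval_poly_def by (intro sum.cong) auto
  also have "\<dots> = (\<Sum>m\<in>M. Poly_Mapping.lookup p m * (\<Prod>i\<in>V. z i ^ Poly_Mapping.lookup m i))"
    using assms by (intro sum.mono_neutral_left) (auto simp: in_keys_iff)
  finally show ?thesis .
qed

lemma eval_poly_in_one_variable:
  assumes "finite V" "poly_vars p \<subseteq> V" "i \<in> V"
  shows "\<exists>P. degree P \<le> partial_degree i p \<and> (\<forall>t. eval_poly p (z(i := t)) = poly P t)"
proof -
  define b where "b m = Poly_Mapping.lookup p m * (\<Prod>j\<in>V - {i}. z j ^ Poly_Mapping.lookup m j)" for m
  define P where "P = (\<Sum>m\<in>Poly_Mapping.keys p. monom (b m) (Poly_Mapping.lookup m i))"
  have "degree P \<le> partial_degree i p"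
    unfolding P_def
  proof (rule degree_sum_le)
    fix m assume "m \<in> Poly_Mapping.keys p"
    then have "Poly_Mapping.lookup m i \<le> partial_degree i p"
      unfolding partial_degree_def by (intro Max_ge) auto
    then show "degree (monom (b m) (Poly_Mapping.lookup m i)) \<le> partial_degree i p"
      using degree_monom_le le_trans by blast
  qed simp
  moreover have "eval_poly p (z(i := t)) = poly P t" for t
  proof -
    have "(\<Prod>j\<in>V. (z(i := t)) j ^ Poly_Mapping.lookup m j)
        = t ^ Poly_Mapping.lookup m i * (\<Prod>j\<in>V - {i}. z j ^ Poly_Mapping.lookup m j)" for m
      using assms by (simp add: prod.remove[of V i])
    then show ?thesis
      using eval_poly_over_superset[OF _ subset_refl assms(1,2), of "z(i := t)"]
      by (simp add: P_def b_def poly_sum poly_monom algebra_simps)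
  qed
  ultimately show ?thesis by blast
qed

lemma wheel_function_linear_combination:
  assumes nl: "n \<ge> 1" "l \<ge> 1" and p: "p \<in> wheel_space n l" and q: "q \<in> wheel_space n l"
  shows "wheel_function n l (\<lambda>z. a * eval_poly p z + b * eval_poly q z)"
proof
  show "n \<ge> 1" "l \<ge> 1" by fact+
next
  fix i z assume i: "i \<in> {1..2*n}"
  have one: "\<exists>P. degree P \<le> l * (n - 1) \<and> (\<forall>t. eval_poly f (z(i := t)) = poly P t)"
    if f: "f \<in> wheel_space n l" for f
  proof -
    have "poly_vars f \<subseteq> {1..2*n}" "partial_degree i f \<le> l * (n - 1)"
      using f i by (auto simp: wheel_space_def)
    then show ?thesis
      using eval_poly_in_one_variable[of "{1..2*n}" f i z] i by (metis finite_atLeastAtMost le_trans)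
  qed
  obtain P Q where "degree P \<le> l * (n - 1)" "\<And>t. eval_poly p (z(i := t)) = poly P t"
    "degree Q \<le> l * (n - 1)" "\<And>t. eval_poly q (z(i := t)) = poly Q t"
    using one[OF p] one[OF q] by blast
  then show "\<exists>P. degree P \<le> l * (n - 1) \<and>
      (\<forall>t. a * eval_poly p (z(i := t)) + b * eval_poly q (z(i := t)) = poly P t)"
    by (intro exI[of _ "smult a P + smult b Q"])
       (auto intro!: degree_add_le order.trans[OF degree_smult_le])
next
  have inv: "eval_poly f (\<lambda>i. z (\<sigma> i)) = eval_poly f z"
    if "permute_vars \<sigma> f = f" "\<sigma> permutes S" for f z \<sigma> S
    using eval_permute_vars[of \<sigma> f z] that permutes_bij by force
  fix \<sigma> z
  {
    assume \<sigma>: "\<sigma> permutes {1..n}"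
    then have "permute_vars \<sigma> p = p" "permute_vars \<sigma> q = q"
      using p q by (auto simp: wheel_space_def)
    then show "a * eval_poly p (\<lambda>i. z (\<sigma> i)) + b * eval_poly q (\<lambda>i. z (\<sigma> i)) = a * eval_poly p z + b * eval_poly q z"
      using inv \<sigma> by metis
  next
    assume \<sigma>: "\<sigma> permutes {n+1..2*n}"
    then have "permute_vars \<sigma> p = p" "permute_vars \<sigma> q = q"
      using p q by (auto simp: wheel_space_def)
    then show "a * eval_poly p (\<lambda>i. z (\<sigma> i)) + b * eval_poly q (\<lambda>i. z (\<sigma> i)) = a * eval_poly p z + b * eval_poly q z"
      using inv \<sigma> by metis
  }
next
  fix i1 i2 i3 s1 s2 :: nat and z :: "nat \<Rightarrow> complex"
  assume "1 \<le> i1" "i1 < i2" "i2 < i3" "i3 \<le> 2 * n" "s1 + s2 + 1 \<le> l"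
    "z i2 = odd_power l s1 * z i1" "z i3 = odd_power l s2 * z i2"
  moreover have "wheel_condition n l p" "wheel_condition n l q"
    using p q by (auto simp: wheel_space_def)
  ultimately have "eval_poly p z = 0" "eval_poly q z = 0"
    unfolding wheel_condition_def odd_power_def by blast+
  then show "a * eval_poly p z + b * eval_poly q z = 0" by simp
qed

theorem lemma4p11:
  fixes n l :: nat
  assumes "n \<ge> 1" and "l \<ge> 1"
  shows "\<forall>p \<in> wheel_space n l. \<forall>q \<in> wheel_space n l.
           \<exists>a b :: complex. (a, b) \<noteq> (0, 0) \<and> scale_poly a p + scale_poly b q = 0"
proof (intro ballI)
  fix p q assume p: "p \<in> wheel_space n l" and q: "q \<in> wheel_space n l"
  \<comment> \<open>midpoints of the intervals of \<open>y_region\<close>; \<open>z0\<close> is the corresponding base point\<close>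
  define Y0 :: "nat \<Rightarrow> complex" where "Y0 j = of_real (real j + 1 / 2)" for j
  define z0 where "z0 i = (if i \<in> {1..n} then odd_power l 0 * Y0 (n + i) else Y0 i)" for i
  obtain a b where ab: "(a, b) \<noteq> (0, 0)" "a * eval_poly p z0 + b * eval_poly q z0 = 0"
  proof (cases "eval_poly p z0 = 0")
    case True then show ?thesis using that[of 1 0] by simp
  next
    case False then show ?thesis using that[of "eval_poly q z0" "- eval_poly p z0"] by simp
  qed
  define r where "r z = a * eval_poly p z + b * eval_poly q z" for z
  interpret wheel_function n l r
    unfolding r_def by (rule wheel_function_linear_combination) fact+
  define V where "V = {1..2*n}"
  define M where "M = Poly_Mapping.keys p \<union> Poly_Mapping.keys q"
  define e where "e m = a * Poly_Mapping.lookup p m + b * Poly_Mapping.lookup q m" for m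
  define A where "A i = (if i \<le> n then UNIV else of_real ` {real i<..<real i + 1} :: complex set)" for i
  have vars: "poly_vars p \<subseteq> V" "poly_vars q \<subseteq> V" using p q by (auto simp: wheel_space_def V_def)
  have r_eq: "r z = (\<Sum>m\<in>M. e m * (\<Prod>i\<in>V. z i ^ Poly_Mapping.lookup m i))" for z
    using eval_poly_over_superset[of M p V z] eval_poly_over_superset[of M q V z] vars
    by (simp add: r_def e_def M_def V_def sum.distrib sum_distrib_left algebra_simps)
  have Y0: "Y0 \<in> y_region"
    unfolding y_region_def Y0_def by (auto intro!: exI[of _ "real _ + 1/2"])
  have base: "r (base_point Y0) = 0"
    using ab(2) by (simp add: r_def base_point_def[abs_def] z0_def[abs_def])
  have van: "r z = 0" if z: "\<forall>i\<in>V. z i \<in> A i" for z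
  proof -
    \<comment> \<open>\<open>z\<close> with the irrelevant coordinates outside \<open>V\<close> reset to those of \<open>Y0\<close>\<close>
    define w where "w i = (if i \<in> V then z i else Y0 i)" for i
    define Y where "Y i = (if i \<in> {n+1..2*n} then z i else Y0 i)" for i
    have "r w = 0"
    proof (rule vanishes_on_y_region[OF Y0 base])
      show "Y \<in> y_region"
        unfolding y_region_def
      proof (intro CollectI ballI)
        fix j assume j: "j \<in> {n+1..2*n}"
        then have "j \<in> V" "\<not> j \<le> n" by (auto simp: V_def)
        then have "z j \<in> of_real ` {real j<..<real j + 1}" using z unfolding A_def by (metis (full_types))
        then show "\<exists>u. real j < u \<and> u < real j + 1 \<and> Y j = of_real u" using j by (auto simp: Y_def)
      qed
      show "Y j = Y0 j" if "j \<notin> {n+1..2*n}" for j using that by (simp only: Y_def if_False)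
      show "same_y Y w" by (auto simp: same_y_def w_def Y_def V_def)
    qed
    moreover have "r w = r z" unfolding r_eq by (simp add: w_def)
    ultimately show ?thesis by simp
  qed
  have "e m = 0" if "m \<in> M" for m
  proof (rule coeffs_zero_if_vanishing_on_product[where V = V and M = M and A = A and e = Poly_Mapping.lookup])
    show "finite V" "finite M" "m \<in> M" using that by (auto simp: V_def M_def)
    show "infinite (A i)" for i
      using infinite_Ioo[of "real i" "real i + 1"]
      by (auto simp: A_def finite_image_iff inj_on_def infinite_UNIV_char_0)
    show "(\<Sum>m\<in>M. e m * (\<Prod>i\<in>V. z i ^ Poly_Mapping.lookup m i)) = 0" if "\<forall>i\<in>V. z i \<in> A i" for z
      using van[OF that] by (simp add: r_eq)
    fix m m' assume m: "m \<in> M" "m' \<in> M" "\<forall>i\<in>V. Poly_Mapping.lookup m i = Poly_Mapping.lookup m' i"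
    have "Poly_Mapping.keys m \<subseteq> V" "Poly_Mapping.keys m' \<subseteq> V"
      using m vars by (auto simp: M_def poly_vars_def)
    then show "m = m'" using m(3)
      by (intro poly_mapping_eqI) (metis in_keys_iff subsetD)
  qed
  then have "e m = 0" for m
    by (cases "m \<in> M") (auto simp: M_def e_def in_keys_iff)
  then have "a * Poly_Mapping.lookup p m + b * Poly_Mapping.lookup q m = 0" for m
    by (simp add: e_def)
  moreover have "Poly_Mapping.lookup (scale_poly k f) m = k * Poly_Mapping.lookup f m" for k f m
    by (simp add: scale_poly_def map.rep_eq when_def)
  ultimately have "scale_poly a p + scale_poly b q = 0"
    by (intro poly_mapping_eqI) (simp add: lookup_add)
  then show "\<exists>a b. (a, b) \<noteq> (0, 0) \<and> scale_poly a p + scale_poly b q = 0"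
    using ab(1) by blast
qed

end
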